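(* Let $X$ be a finite set. If $(S_1,R)$ and $(S_2,R)$ are two Catalan pairs on $X$ (with the same second component $R$), then they are isomorphic, i.e. there is a bijection $\xi:X\to X$ such that for all $x,y\in X$: $xS_1y\iff \xi(x)S_2\xi(y)$, and $xRy\iff \xi(x)R\xi(y)$.
   Context: For a finite set $X$, let $\mathcal{D}=\{(x,x)\mid x\in X\}$; for a binary relation $\theta$ on $X$ let $\overline{\theta}=\theta\cup\theta^{-1}$; for binary relations $A,B$ on $X$, $A\circ B=\{(x,z)\mid \exists y\in X:\ xAy \text{ and } yBz\}$. Let $\mathcal{O}(X)$ be the set of strict order relations on $X$ (irreflexive and transitive binary relations). A Catalan pair on $X$ is an ordered pair $(S,R)$ of binary relations on $X$ such that: (ord S) $S\in\mathcal{O}(X)$; (ord R) $R\in\mathcal{O}(X)$; (tot) $\overline{R}\cup\overline{S}=X^2\setminus\mathcal{D}$; (inters) $\overline{R}\cap\overline{S}=\emptyset$; (comp) $S\circ R\subseteq R$. *)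

theory Defs
  imports Main
begin

definition strict_orders :: "'a set \<Rightarrow> 'a rel set" where
  "strict_orders X = {\<theta>. \<theta> \<subseteq> X \<times> X \<and> irrefl \<theta> \<and> trans \<theta>}"

definition sym_closure :: "'a rel \<Rightarrow> 'a rel" where
  "sym_closure \<theta> = \<theta> \<union> \<theta>\<inverse>"

(* The composition A \<circ> B = {(x, z). \<exists>y. x A y \<and> y B z} is the library's A O B
   (left relation applied first). *)
definition catalan_pair :: "'a set \<Rightarrow> 'a rel \<Rightarrow> 'a rel \<Rightarrow> bool" where
  "catalan_pair X S R \<longleftrightarrow>
     S \<in> strict_orders X \<and>
     R \<in> strict_orders X \<and>
     sym_closure R \<union> sym_closure S = X \<times> X - Id_on X \<and>
     sym_closure R \<inter> sym_closure S = {} \<and>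
     S O R \<subseteq> R"

end

theory Submission
  imports Defs
begin

text \<open>
  The relation \<open>R\<close> determines \<open>S\<close> up to a choice that isomorphisms do not see. Two distinct points
  are comparable in exactly one of \<open>R\<close> and \<open>S\<close>, and \<open>(x, y) \<in> S\<close> forces \<open>y\<close> to have at most the
  \<open>R\<close>-successors and at most the \<open>R\<close>-predecessors of \<open>x\<close> (lemmas \<open>catalan_pair_successors\<close> and
  \<open>catalan_pair_predecessors\<close>). So if two \<open>R\<close>-incomparable points have different
  \<open>R\<close>-neighbourhoods, these neighbourhoods tell in which direction \<open>S\<close> relates the points
  (lemma \<open>catalan_pair_iff_not_twins\<close>).

  What remains are twins: points with the same \<open>R\<close>-successors and the same \<open>R\<close>-predecessors. A
  class of twins is an \<open>R\<close>-antichain, hence a chain of \<open>S\<close>, and permuting its points changes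
  neither \<open>R\<close> nor the part of \<open>S\<close> that \<open>R\<close> determines. The isomorphism therefore maps each class
  of twins to itself, along the only order isomorphism between the two chains that \<open>S\<^sub>1\<close> and
  \<open>S\<^sub>2\<close> make of it: it sends each point to the point of the same rank.
\<close>

definition twins :: "'a rel \<Rightarrow> 'a \<Rightarrow> 'a \<Rightarrow> bool" where
  "twins R x y \<longleftrightarrow> R `` {x} = R `` {y} \<and> R\<inverse> `` {x} = R\<inverse> `` {y}"

definition twin_class :: "'a set \<Rightarrow> 'a rel \<Rightarrow> 'a \<Rightarrow> 'a set" where
  "twin_class X R x = {y \<in> X. twins R x y}"

lemma twins_refl: "twins R x x"
  by (simp add: twins_def)

lemma twin_class_cong: "twins R x y \<Longrightarrow> twin_class X R x = twin_class X R y"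
  by (auto simp: twin_class_def twins_def)

lemma twins_rel_iff:
  assumes "twins R x x'" "twins R y y'"
  shows "(x, y) \<in> R \<longleftrightarrow> (x', y') \<in> R"
proof -
  have "(x, y) \<in> R \<longleftrightarrow> (x', y) \<in> R"
    using assms(1) unfolding twins_def by blast
  also have "\<dots> \<longleftrightarrow> (x', y') \<in> R"
    using assms(2) unfolding twins_def by blast
  finally show ?thesis .
qed

lemma catalan_pairD:
  assumes "catalan_pair X S R"
  shows "S \<subseteq> X \<times> X" "R \<subseteq> X \<times> X" "irrefl S" "irrefl R" "trans S" "trans R"
    and catalan_pair_total: "\<And>x y. x \<in> X \<Longrightarrow> y \<in> X \<Longrightarrow> x \<noteq> y \<Longrightarrow>
           (x, y) \<in> S \<or> (y, x) \<in> S \<or> (x, y) \<in> R \<or> (y, x) \<in> R"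
    and catalan_pair_disjoint: "\<And>x y. (x, y) \<in> S \<Longrightarrow> (x, y) \<notin> R \<and> (y, x) \<notin> R"
    and catalan_pair_comp: "\<And>x y z. (x, y) \<in> S \<Longrightarrow> (y, z) \<in> R \<Longrightarrow> (x, z) \<in> R"
proof -
  have tot: "sym_closure R \<union> sym_closure S = X \<times> X - Id_on X"
    and dis: "sym_closure R \<inter> sym_closure S = {}"
    using assms unfolding catalan_pair_def by blast+
  show "S \<subseteq> X \<times> X" "R \<subseteq> X \<times> X" "irrefl S" "irrefl R" "trans S" "trans R"
    using assms unfolding catalan_pair_def strict_orders_def by blast+
  show "(x, y) \<in> S \<or> (y, x) \<in> S \<or> (x, y) \<in> R \<or> (y, x) \<in> R"
    if "x \<in> X" "y \<in> X" "x \<noteq> y" for x y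
  proof -
    have "(x, y) \<in> sym_closure R \<union> sym_closure S"
      unfolding tot using that by auto
    then show ?thesis unfolding sym_closure_def by blast
  qed
  show "(x, y) \<notin> R \<and> (y, x) \<notin> R" if "(x, y) \<in> S" for x y
    using dis that unfolding sym_closure_def by blast
  show "(x, z) \<in> R" if "(x, y) \<in> S" "(y, z) \<in> R" for x y z
    using assms that unfolding catalan_pair_def by blast
qed

lemma catalan_pair_successors:
  assumes "catalan_pair X S R" "(x, y) \<in> S"
  shows "R `` {y} \<subseteq> R `` {x}"
  using catalan_pair_comp[OF assms] by blast

text \<open>
  Let \<open>z\<close> be an \<open>R\<close>-predecessor of \<open>y\<close>. If \<open>(z, x)\<close> were not in \<open>R\<close>, then either \<open>z = x\<close>, or the
  two points would be related by \<open>S\<close> or as \<open>(x, z) \<in> R\<close>. In each case transitivity or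
  \<open>S \<circ> R \<subseteq> R\<close> makes \<open>y\<close> comparable in both relations to \<open>x\<close> or to \<open>z\<close>, which disjointness
  excludes.
\<close>

lemma catalan_pair_predecessors:
  assumes cp: "catalan_pair X S R" and xy: "(x, y) \<in> S"
  shows "R\<inverse> `` {y} \<subseteq> R\<inverse> `` {x}"
proof
  fix z assume "z \<in> R\<inverse> `` {y}"
  then have zy: "(z, y) \<in> R" by blast
  have "z \<in> X" "x \<in> X"
    using zy xy catalan_pairD(1,2)[OF cp] by blast+
  moreover have "z \<noteq> x"
    using zy xy catalan_pair_disjoint[OF cp] by blast
  moreover have "(z, x) \<notin> S"
    using zy xy catalan_pair_disjoint[OF cp] catalan_pairD(5)[OF cp] by (meson transD)
  moreover have "(x, z) \<notin> S"
    using zy xy catalan_pair_disjoint[OF cp] catalan_pair_comp[OF cp] by blast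
  moreover have "(x, z) \<notin> R"
    using zy xy catalan_pair_disjoint[OF cp] catalan_pairD(6)[OF cp] by (meson transD)
  ultimately show "z \<in> R\<inverse> `` {x}"
    using catalan_pair_total[OF cp] by blast
qed

text \<open>
  The right-hand side mentions only \<open>R\<close>, and only through the neighbourhoods of the two points;
  so it does not change when \<open>S\<close> is exchanged or when a point is replaced by a twin.
\<close>

lemma catalan_pair_iff_not_twins:
  assumes cp: "catalan_pair X S R" and X: "x \<in> X" "y \<in> X" and nt: "\<not> twins R x y"
  shows "(x, y) \<in> S \<longleftrightarrow> (x, y) \<notin> R \<and> (y, x) \<notin> R \<and>
           R `` {y} \<subseteq> R `` {x} \<and> R\<inverse> `` {y} \<subseteq> R\<inverse> `` {x}"
    (is "_ \<longleftrightarrow> ?rhs")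
proof
  assume "(x, y) \<in> S"
  then show ?rhs
    using catalan_pair_disjoint[OF cp] catalan_pair_successors[OF cp]
      catalan_pair_predecessors[OF cp] by blast
next
  assume r: ?rhs
  have "x \<noteq> y" using nt twins_refl by metis
  moreover have "(y, x) \<notin> S"
  proof
    assume "(y, x) \<in> S"
    then have "R `` {x} \<subseteq> R `` {y}" "R\<inverse> `` {x} \<subseteq> R\<inverse> `` {y}"
      using catalan_pair_successors[OF cp] catalan_pair_predecessors[OF cp] by blast+
    then show False using r nt unfolding twins_def by blast
  qed
  ultimately show "(x, y) \<in> S"
    using r X catalan_pair_total[OF cp] by blast
qed

lemma total_on_twin_class:
  assumes cp: "catalan_pair X S R"
  shows "total_on (twin_class X R c) S"
proof (rule total_onI)
  fix x y assume xy: "x \<in> twin_class X R c" "y \<in> twin_class X R c" "x \<noteq> y"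
  then have "twins R x y" unfolding twin_class_def twins_def by auto
  \<comment> \<open>if one twin were related to the other, it would be related to itself\<close>
  then have "(x, y) \<notin> R" "(y, x) \<notin> R"
    using catalan_pairD(4)[OF cp] unfolding twins_def irrefl_def by blast+
  then show "(x, y) \<in> S \<or> (y, x) \<in> S"
    using xy catalan_pair_total[OF cp] unfolding twin_class_def by blast
qed

definition rank :: "'a rel \<Rightarrow> 'a set \<Rightarrow> 'a \<Rightarrow> nat" where
  "rank S C x = card {y \<in> C. (y, x) \<in> S}"

lemma rank_strict_mono:
  assumes "finite C" "irrefl S" "trans S" "x \<in> C" "(x, y) \<in> S"
  shows "rank S C x < rank S C y"
  unfolding rank_def
proof (rule psubset_card_mono)
  show "finite {z \<in> C. (z, y) \<in> S}" using assms(1) by simp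
  show "{z \<in> C. (z, x) \<in> S} \<subset> {z \<in> C. (z, y) \<in> S}"
    using assms(2-5) by (auto simp: irrefl_def dest: transD)
qed

lemma rank_less_iff:
  assumes "finite C" "irrefl S" "trans S" "total_on C S" "x \<in> C" "y \<in> C"
  shows "rank S C x < rank S C y \<longleftrightarrow> (x, y) \<in> S"
  using assms rank_strict_mono[OF assms(1-3)] unfolding total_on_def
  by (metis less_irrefl less_asym)

lemma bij_betw_rank:
  assumes "finite C" "irrefl S" "trans S" "total_on C S"
  shows "bij_betw (rank S C) C {..<card C}"
proof -
  have inj: "inj_on (rank S C) C"
    using rank_strict_mono[OF assms(1-3)] assms(4) unfolding total_on_def inj_on_def
    by (metis less_irrefl)
  have "rank S C x < card C" if "x \<in> C" for x
    unfolding rank_def using that assms(1,2)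
    by (intro psubset_card_mono) (auto simp: irrefl_def)
  then have "rank S C ` C \<subseteq> {..<card C}" by blast
  moreover have "card (rank S C ` C) = card {..<card C}"
    using inj by (simp add: card_image)
  ultimately have "rank S C ` C = {..<card C}"
    by (simp add: card_subset_eq)
  then show ?thesis using inj by (simp add: bij_betw_def)
qed

theorem theorem4p1:
  fixes X :: "'a set" and S1 S2 R :: "'a rel"
  assumes "finite X"
    and "catalan_pair X S1 R"
    and "catalan_pair X S2 R"
  shows "\<exists>\<xi>. bij_betw \<xi> X X \<and>
           (\<forall>x\<in>X. \<forall>y\<in>X. ((x, y) \<in> S1 \<longleftrightarrow> (\<xi> x, \<xi> y) \<in> S2) \<and>
                         ((x, y) \<in> R \<longleftrightarrow> (\<xi> x, \<xi> y) \<in> R))"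
proof -
  note cp = assms(2,3)
  let ?C = "twin_class X R"
  have fin: "finite (?C x)" for x
    using assms(1) unfolding twin_class_def by simp
  have in_class: "x \<in> ?C x" if "x \<in> X" for x
    using that unfolding twin_class_def by (simp add: twins_refl)
  note chain1 = fin catalan_pairD(3,5)[OF cp(1)] total_on_twin_class[OF cp(1)]
  note chain2 = fin catalan_pairD(3,5)[OF cp(2)] total_on_twin_class[OF cp(2)]
  have "\<exists>y \<in> ?C x. rank S2 (?C x) y = rank S1 (?C x) x" if "x \<in> X" for x
  proof -
    have "rank S1 (?C x) x \<in> {..<card (?C x)}"
      using bij_betwE[OF bij_betw_rank[OF chain1]] in_class[OF that] by blast
    then show ?thesis
      using bij_betw_imp_surj_on[OF bij_betw_rank[OF chain2]] by (metis imageE)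
  qed
  then obtain \<xi> where \<xi>: "\<And>x. x \<in> X \<Longrightarrow> \<xi> x \<in> ?C x"
    "\<And>x. x \<in> X \<Longrightarrow> rank S2 (?C x) (\<xi> x) = rank S1 (?C x) x"
    by metis
  have \<xi>X: "\<xi> x \<in> X" and tw: "twins R x (\<xi> x)" if "x \<in> X" for x
    using \<xi>(1)[OF that] unfolding twin_class_def by auto
  have "inj_on \<xi> X"
  proof (rule inj_onI)
    fix x y assume xy: "x \<in> X" "y \<in> X" "\<xi> x = \<xi> y"
    then have C: "?C x = ?C y"
      using twin_class_cong[OF tw] by metis
    then have "rank S1 (?C x) x = rank S1 (?C x) y"
      using \<xi>(2) xy by metis
    then show "x = y"
      using bij_betw_imp_inj_on[OF bij_betw_rank[OF chain1]] in_class xy(1,2) C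
      by (metis inj_onD)
  qed
  then have "bij_betw \<xi> X X"
    using \<xi>X assms(1) by (simp add: bij_betw_def endo_inj_surj image_subsetI)
  moreover have "(x, y) \<in> R \<longleftrightarrow> (\<xi> x, \<xi> y) \<in> R" if "x \<in> X" "y \<in> X" for x y
    using twins_rel_iff tw that by metis
  moreover have "(x, y) \<in> S1 \<longleftrightarrow> (\<xi> x, \<xi> y) \<in> S2" if X: "x \<in> X" "y \<in> X" for x y
  proof (cases "twins R x y")
    case True
    then have C: "?C y = ?C x" by (metis twin_class_cong)
    have "(x, y) \<in> S1 \<longleftrightarrow> rank S1 (?C x) x < rank S1 (?C x) y"
      using rank_less_iff[OF chain1] in_class X C by metis
    also have "\<dots> \<longleftrightarrow> rank S2 (?C x) (\<xi> x) < rank S2 (?C x) (\<xi> y)"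
      using \<xi>(2) X C by metis
    also have "\<dots> \<longleftrightarrow> (\<xi> x, \<xi> y) \<in> S2"
      using rank_less_iff[OF chain2] \<xi>(1) X C by metis
    finally show ?thesis .
  next
    case False
    then have "\<not> twins R (\<xi> x) (\<xi> y)"
      using tw X unfolding twins_def by metis
    note char2 = catalan_pair_iff_not_twins[OF cp(2) \<xi>X[OF X(1)] \<xi>X[OF X(2)] this]
    show ?thesis
      unfolding catalan_pair_iff_not_twins[OF cp(1) X False] char2
      using tw[OF X(1)] tw[OF X(2)] twins_rel_iff[of R x "\<xi> x" y "\<xi> y"]
        twins_rel_iff[of R y "\<xi> y" x "\<xi> x"]
      unfolding twins_def by simp
  qed
  ultimately show ?thesis by blast
qed

end
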